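(* Let $t,g\ge 1$ be integers, let $\epsilon>0$, and let $I$ be a positive integer (the number of generators). Let $\phi(\gamma;\theta)$, $\Phi$, $w^*$, $q^*$, $h_i$ and $\breve{\mathsf{cl}}\,h_i$ be as defined in the context, with $\theta\in\mathbb{R}^t$ and $\gamma_1,\dots,\gamma_I\in\mathbb{R}^g$. Let $\Delta_\gamma^i:=\sup_{\mathbf{u}\in\mathbb{R}^t}\{h_i(\mathbf{u})-\breve{\mathsf{cl}}\,h_i(\mathbf{u})\}\ge 0$ and $\Delta_\gamma^{\mathsf{worst}}:=\max_{1\le i\le I}\Delta_\gamma^i$. Suppose that, for every $i$, $h_i$ is continuous and $\mathsf{dom}\,h_i$ is compact and convex, and that $\phi(\gamma_i;\theta)$ is concave and closed with respect to the discriminator parameter $\theta$. If $I>\frac{t+1}{\epsilon}\Delta_\gamma^{\mathsf{worst}}$, then $$0\le w^*-q^*\le\epsilon .$$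
   Context: Payoff. $\mathcal{P}_d$ is the data distribution, $\mathcal{P}_z$ a noise distribution, $D_\theta(\mathbf{x})$ (the output probability of the discriminator, in $[0,1]$) is parametrized by $\theta\in\mathbb{R}^t$, $G_\gamma(\mathbf{z})$ (the generator) is parametrized by $\gamma\in\mathbb{R}^g$, and $f$ is a concave increasing function. Define $$\phi(\gamma;\theta):=\mathbb{E}_{\mathbf{x}\sim\mathcal{P}_d} f(D_\theta(\mathbf{x}))+\mathbb{E}_{\mathbf{z}\sim\mathcal{P}_z} f(1-D_\theta(G_\gamma(\mathbf{z}))),\qquad \Phi(\gamma_1,\dots,\gamma_I;\theta):=\sum_{i=1}^I\phi(\gamma_i;\theta).$$ Minimax and maximin values. $$w^*:=\inf_{\gamma_1,\dots,\gamma_I\in\mathbb{R}^g}\sup_{\theta\in\mathbb{R}^t}\tfrac1I\Phi(\gamma_1,\dots,\gamma_I;\theta),\qquad q^*:=\sup_{\theta\in\mathbb{R}^t}\inf_{\gamma_1,\dots,\gamma_I\in\mathbb{R}^g}\tfrac1I\Phi(\gamma_1,\dots,\gamma_I;\theta).$$ Functions $h_i$. For a function $F$, $F^*(\mathbf{v}):=\sup_{\mathbf{u}}\{\mathbf{u}^T\mathbf{v}-F(\mathbf{u})\}$ is its conjugate. Define $h_i(\mathbf{u}_i):=\inf_{\gamma_i\in\mathbb{R}^g}(-\phi(\gamma_i;\cdot))^*(\mathbf{u}_i)$ for $\mathbf{u}_i\in\mathbb{R}^t$, the conjugate being taken in the second argument $\theta$; $\mathsf{dom}\,h_i$ is the set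 where $h_i<+\infty$, and continuity of $h_i$ means continuity on $\mathsf{dom}\,h_i$. Its convex closure is $$\breve{\mathsf{cl}}\,h_i(\widetilde{\mathbf{u}}):=\inf_{\{a^j\},\{\mathbf{u}_i^j\}}\Big\{\sum_{j=1}^{t+2}a^jh_i(\mathbf{u}_i^j):\ \widetilde{\mathbf{u}}=\sum_{j=1}^{t+2}a^j\mathbf{u}_i^j,\ \sum_{j=1}^{t+2}a^j=1,\ a^j\ge0\Big\}.$$ In $\Delta_\gamma^i$ the difference is read as $0$ at points outside $\mathsf{dom}\,h_i$, where both functions are $+\infty$. A concave function is closed if its hypograph is closed (equivalently, the epigraph of its negative is closed). *)

theory Defs
  imports "HOL-Probability.Probability"
begin

definition hypograph_on :: "'a set \<Rightarrow> ('a \<Rightarrow> ereal) \<Rightarrow> ('a \<times> real) set" where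
  "hypograph_on S F = {(x, r). x \<in> S \<and> ereal r \<le> F x}"

definition ereal_concave_on :: "'a::real_vector set \<Rightarrow> ('a \<Rightarrow> ereal) \<Rightarrow> bool" where
  "ereal_concave_on S F \<longleftrightarrow> convex (hypograph_on S F)"

definition closed_concave :: "('a::euclidean_space \<Rightarrow> ereal) \<Rightarrow> bool" where
  "closed_concave F \<longleftrightarrow> ereal_concave_on UNIV F \<and> closed (hypograph_on UNIV F)"

text \<open>
  Positive part minus negative part (\<^const>\<open>e2ennreal\<close> sends negative values to 0).
  It is used only for functions bounded above by a finite constant on a probability
  space, where the first integral is finite; the value may then be \<open>-\<infinity>\<close>,
  as for the logarithm.
\<close>
definition ereal_expectation :: "'a measure \<Rightarrow> ('a \<Rightarrow> ereal) \<Rightarrow> ereal" where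
  "ereal_expectation M X =
     enn2ereal (\<integral>\<^sup>+ x. e2ennreal (X x) \<partial>M) - enn2ereal (\<integral>\<^sup>+ x. e2ennreal (- X x) \<partial>M)"

definition payoff ::
  "'x measure \<Rightarrow> 'z measure \<Rightarrow> (real \<Rightarrow> ereal) \<Rightarrow> ('th \<Rightarrow> 'x \<Rightarrow> real) \<Rightarrow> ('ga \<Rightarrow> 'z \<Rightarrow> 'x)
     \<Rightarrow> 'ga \<Rightarrow> 'th \<Rightarrow> ereal" where
  "payoff Pd Pz f D G \<gamma> \<theta> =
     ereal_expectation Pd (\<lambda>x. f (D \<theta> x)) + ereal_expectation Pz (\<lambda>z. f (1 - D \<theta> (G \<gamma> z)))"

definition total_payoff ::
  "('ga \<Rightarrow> 'th \<Rightarrow> ereal) \<Rightarrow> nat \<Rightarrow> (nat \<Rightarrow> 'ga) \<Rightarrow> 'th \<Rightarrow> ereal" where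
  "total_payoff \<phi> I \<gamma> \<theta> = (\<Sum>i=1..I. \<phi> (\<gamma> i) \<theta>)"

definition minimax_value :: "('ga \<Rightarrow> 'th \<Rightarrow> ereal) \<Rightarrow> nat \<Rightarrow> ereal" where
  "minimax_value \<phi> I =
     (INF \<gamma> \<in> {1..I} \<rightarrow>\<^sub>E UNIV. SUP \<theta>. ereal (1 / real I) * total_payoff \<phi> I \<gamma> \<theta>)"

definition maximin_value :: "('ga \<Rightarrow> 'th \<Rightarrow> ereal) \<Rightarrow> nat \<Rightarrow> ereal" where
  "maximin_value \<phi> I =
     (SUP \<theta>. INF \<gamma> \<in> {1..I} \<rightarrow>\<^sub>E UNIV. ereal (1 / real I) * total_payoff \<phi> I \<gamma> \<theta>)"

definition conjugate :: "('a::real_inner \<Rightarrow> ereal) \<Rightarrow> 'a \<Rightarrow> ereal" where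
  "conjugate F v = (SUP u. ereal (u \<bullet> v) - F u)"

text \<open>
  All generators share the payoff \<open>\<phi>\<close>, so the function \<open>h\<^sub>i\<close> is the same for every \<open>i\<close>;
  the index is kept only to match the usual notation.
\<close>
definition gen_h :: "('ga \<Rightarrow> 'th::real_inner \<Rightarrow> ereal) \<Rightarrow> nat \<Rightarrow> 'th \<Rightarrow> ereal" where
  "gen_h \<phi> i u = (INF \<gamma>. conjugate (\<lambda>\<theta>. - \<phi> \<gamma> \<theta>) u)"

definition eff_dom :: "('a \<Rightarrow> ereal) \<Rightarrow> 'a set" where
  "eff_dom h = {u. h u < \<infinity>}"

text \<open>
  Here \<open>0 * \<infinity> = 0\<close> and \<open>\<infinity> + (-\<infinity>) = \<infinity>\<close>, so a point outside the domain
  contributes nothing with weight 0 and makes the sum \<open>\<infinity>\<close> with positive weight.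
\<close>
definition convex_closure :: "('a::euclidean_space \<Rightarrow> ereal) \<Rightarrow> 'a \<Rightarrow> ereal" where
  "convex_closure h v =
     Inf {\<Sum>j=1..DIM('a) + 2. ereal (a j) * h (u j) | (a :: nat \<Rightarrow> real) (u :: nat \<Rightarrow> 'a).
            v = (\<Sum>j=1..DIM('a) + 2. a j *\<^sub>R u j) \<and>
            (\<Sum>j=1..DIM('a) + 2. a j) = 1 \<and>
            (\<forall>j\<in>{1..DIM('a) + 2}. 0 \<le> a j)}"

text \<open>
  The case distinction is needed because \<open>\<infinity> - \<infinity> = \<infinity>\<close> in \<^typ>\<open>ereal\<close>.
\<close>
definition nonconvexity :: "('a::euclidean_space \<Rightarrow> ereal) \<Rightarrow> ereal" where
  "nonconvexity h = (SUP u. if u \<in> eff_dom h then h u - convex_closure h u else 0)"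

definition worst_nonconvexity ::
  "('ga \<Rightarrow> 'th::euclidean_space \<Rightarrow> ereal) \<Rightarrow> nat \<Rightarrow> ereal" where
  "worst_nonconvexity \<phi> I = Max ((\<lambda>i. nonconvexity (gen_h \<phi> i)) ` {1..I})"

lemma convex_closure_le: "convex_closure h v \<le> h v"
proof -
  let ?a = "\<lambda>j::nat. if j = 1 then 1 else 0 :: real"
  have "h v = (\<Sum>j=1..DIM('a) + 2. ereal (?a j) * h v)"
    by (subst sum.remove[of _ 1])
      (auto intro!: sum.neutral simp: one_ereal_def[symmetric] zero_ereal_def[symmetric])
  moreover have "v = (\<Sum>j=1..DIM('a) + 2. ?a j *\<^sub>R v)"
    by (subst sum.remove[of _ 1]) (auto intro!: sum.neutral)
  moreover have "(\<Sum>j=1..DIM('a) + 2. ?a j) = 1"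
    by (subst sum.remove[of _ 1]) (auto intro!: sum.neutral)
  ultimately show ?thesis
    unfolding convex_closure_def
    by (intro Inf_lower CollectI exI[of _ ?a] exI[of _ "\<lambda>_. v"]) auto
qed

lemma nonconvexity_nonneg: "0 \<le> nonconvexity h"
proof -
  have "0 \<le> (if u \<in> eff_dom h then h u - convex_closure h u else 0)" for u
    using convex_closure_le[of h u] by (cases "h u"; cases "convex_closure h u") auto
  then show ?thesis
    unfolding nonconvexity_def by (rule SUP_upper2[OF UNIV_I])
qed

end

theory Submission imports Defs begin

text \<open>
  Both values are compared with the convex closure of \<open>h\<close> at \<open>0\<close>. From below: the graph of \<open>h\<close>
  has a compact convex hull, so a hyperplane separates it from a vertical ray under
  \<open>(0, convex_closure h 0)\<close>; its slope is a parameter \<open>\<theta>\<close> which, by biconjugation of the closed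
  concave functions \<open>\<phi> \<gamma>\<close>, nearly attains that value in the maximin problem. From above: points
  \<open>u\<^sub>1, \<dots>, u\<^sub>I\<close> with sum \<open>0\<close> yield generators whose worst payoff is at most the mean of the
  \<open>h u\<^sub>i\<close>, and such points can be chosen with mean at most \<open>(t + 1) \<Delta> / I\<close> above the convex
  closure.
\<close>

section \<open>Biconjugation of closed concave functions\<close>

text \<open>The assumption on conjugates says that each affine majorant of \<open>F\<close> is at
  least \<open>s\<close> at \<open>\<theta>\<^sub>0\<close>. If (\<open>\<theta>\<^sub>0\<close>,
  \<open>s\<close>) lay outside the closed convex hypograph, a separating hyperplane would give an
  affine majorant violating this.\<close>

lemma closed_concave_ge_if_conjugate_ge:
  fixes F :: "'a::euclidean_space \<Rightarrow> ereal"
  assumes "closed_concave F" and bound: "\<And>\<theta>. F \<theta> \<le> ereal C"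
    and conj: "\<And>v. ereal (\<theta>\<^sub>0 \<bullet> v + s) \<le> conjugate (\<lambda>\<theta>. - F \<theta>) v"
  shows "ereal s \<le> F \<theta>\<^sub>0"
proof (rule ccontr)
  assume "\<not> ereal s \<le> F \<theta>\<^sub>0"
  then have out: "(\<theta>\<^sub>0, s) \<notin> hypograph_on UNIV F"
    by (simp add: hypograph_on_def)
  have majorant: "\<theta>\<^sub>0 \<bullet> v + s \<le> c"
    if "\<And>\<theta> r. ereal r \<le> F \<theta> \<Longrightarrow> \<theta> \<bullet> v + r \<le> c" for v c
  proof -
    have "ereal (\<theta> \<bullet> v) - - F \<theta> \<le> ereal c" for \<theta>
      using that[of "real_of_ereal (F \<theta>)" \<theta>] bound[of \<theta>] by (cases "F \<theta>") auto
    then have "conjugate (\<lambda>\<theta>. - F \<theta>) v \<le> ereal c"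
      unfolding conjugate_def by (intro SUP_least)
    then show ?thesis
      using conj[of v] by (metis ereal_less_eq(3) order_trans)
  qed
  \<comment> \<open>With an empty hypograph, \<open>majorant\<close> would hold vacuously for every
    \<open>c\<close>.\<close>
  have nonempty: "\<exists>\<theta> r. ereal r \<le> F \<theta>"
  proof (rule ccontr)
    assume "\<nexists>\<theta> r. ereal r \<le> F \<theta>"
    then show False
      using majorant[of 0 "s - 1"] by auto
  qed
  have "convex (hypograph_on UNIV F)" "closed (hypograph_on UNIV F)"
    using assms(1) by (simp_all add: closed_concave_def ereal_concave_on_def)
  from separating_hyperplane_closed_point[OF this out]
  obtain u \<beta> b where pt: "u \<bullet> \<theta>\<^sub>0 + \<beta> * s < b"
    and sep: "\<And>\<theta> r. ereal r \<le> F \<theta> \<Longrightarrow> b < u \<bullet> \<theta> + \<beta> * r"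
    by (force simp: hypograph_on_def)
  have "\<beta> \<le> 0"
  proof (rule ccontr)
    assume "\<not> \<beta> \<le> 0"
    then have "0 < \<beta>" by simp
    from nonempty obtain \<theta> r where r: "ereal r \<le> F \<theta>" by auto
    \<comment> \<open>The hypograph is unbounded downwards: for positive \<open>\<beta>\<close>,
      lowering \<open>r\<close> this far crosses the hyperplane.\<close>
    define r' where "r' = min r ((b - u \<bullet> \<theta>) / \<beta>)"
    have "ereal r' \<le> ereal r" by (simp add: r'_def)
    then have "b < u \<bullet> \<theta> + \<beta> * r'"
      using sep r order_trans by blast
    moreover have "\<beta> * r' \<le> \<beta> * ((b - u \<bullet> \<theta>) / \<beta>)"
      using \<open>0 < \<beta>\<close> by (intro mult_left_mono) (auto simp: r'_def)
    ultimately show False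
      using \<open>0 < \<beta>\<close> by simp
  qed
  then consider "\<beta> < 0" | "\<beta> = 0" by linarith
  then show False
  proof cases
    case 1
    have "\<theta>\<^sub>0 \<bullet> (u /\<^sub>R \<beta>) + s \<le> b / \<beta>"
    proof (rule majorant)
      fix \<theta> r assume "ereal r \<le> F \<theta>"
      from sep[OF this] 1 have "(u \<bullet> \<theta> + \<beta> * r) / \<beta> \<le> b / \<beta>"
        by (intro divide_right_mono_neg) auto
      then show "\<theta> \<bullet> (u /\<^sub>R \<beta>) + r \<le> b / \<beta>"
        using 1 by (simp add: inner_commute field_simps)
    qed
    moreover have "b / \<beta> < (u \<bullet> \<theta>\<^sub>0 + \<beta> * s) / \<beta>"
      using pt 1 by (intro divide_strict_right_mono_neg)
    moreover have "(u \<bullet> \<theta>\<^sub>0 + \<beta> * s) / \<beta> = \<theta>\<^sub>0 \<bullet> (u /\<^sub>R \<beta>) + s"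
      using 1 by (simp add: inner_commute field_simps)
    ultimately show False by simp
  next
    \<comment> \<open>A vertical separator becomes an affine majorant after scaling, because \<open>F\<close> is bounded above.\<close>
    case 2
    \<comment> \<open>Chosen so that the majorant \<open>C + k * (u \<bullet> \<theta> - b)\<close>
      falls below \<open>s\<close> at \<open>\<theta>\<^sub>0\<close>.\<close>
    define k where "k = (\<bar>C - s\<bar> + 1) / (b - u \<bullet> \<theta>\<^sub>0)"
    have "0 < b - u \<bullet> \<theta>\<^sub>0" using pt 2 by simp
    then have "0 < k" and k: "k * (b - u \<bullet> \<theta>\<^sub>0) = \<bar>C - s\<bar> + 1"
      by (simp_all add: k_def)
    have "\<theta>\<^sub>0 \<bullet> (- k *\<^sub>R u) + s \<le> - k * b + C"
    proof (rule majorant)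
      fix \<theta> r assume r: "ereal r \<le> F \<theta>"
      then have "r \<le> C"
        using bound[of \<theta>] by (metis ereal_less_eq(3) order_trans)
      moreover have "k * b \<le> k * (u \<bullet> \<theta>)"
        using sep[OF r] 2 \<open>0 < k\<close> by (intro mult_left_mono) auto
      ultimately show "\<theta> \<bullet> (- k *\<^sub>R u) + r \<le> - k * b + C"
        by (simp add: inner_commute)
    qed
    with k show False
      by (simp add: inner_commute algebra_simps)
  qed
qed

section \<open>Convex closure and the convex hull of the graph\<close>

text \<open>The graph lives in dimension \<open>DIM('a) + 1\<close>, so by Caratheodory
  \<open>DIM('a) + 2\<close> points suffice, exactly the number that \<open>convex_closure\<close>
  allows. Smaller families are padded with weight 0.\<close>

lemma convex_closure_le_if_mem_hull_graph:
  fixes h :: "'a::euclidean_space \<Rightarrow> ereal"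
  assumes h: "\<And>u. u \<in> S \<Longrightarrow> h u = ereal (H u)"
    and mem: "(v, r) \<in> convex hull ((\<lambda>u. (u, H u)) ` S)"
  shows "convex_closure h v \<le> ereal r"
proof -
  from mem[unfolded convex_hull_caratheodory] obtain T and w :: "'a \<times> real \<Rightarrow> real"
    where T: "finite T" "T \<subseteq> (\<lambda>u. (u, H u)) ` S" "card T \<le> DIM('a) + 2"
    and w: "\<forall>x\<in>T. 0 \<le> w x" "sum w T = 1" "(\<Sum>x\<in>T. w x *\<^sub>R x) = (v, r)"
    by auto
  obtain e where e: "bij_betw e {1..card T} T"
    using T(1) ex_bij_betw_nat_finite_1 by blast
  let ?N = "DIM('a) + 2"
  define a where "a j = (if j \<in> {1..card T} then w (e j) else 0)" for j
  \<comment> \<open>Beyond \<open>card T\<close> the value of \<open>u j\<close> is arbitrary; its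
    weight is 0, and \<open>0 * \<infinity> = 0\<close>.\<close>
  define u where "u j = fst (e j)" for j
  have ext: "(\<Sum>j=1..?N. g j) = (\<Sum>j=1..card T. g j)"
    if "\<And>j. j \<notin> {1..card T} \<Longrightarrow> g j = 0" for g :: "nat \<Rightarrow> 'c::comm_monoid_add"
    using T(3) by (intro sum.mono_neutral_right) (auto intro: that)
  have eT: "e j \<in> T" if "j \<in> {1..card T}" for j
    using e that by (auto simp: bij_betw_def)
  have eS: "u j \<in> S" "snd (e j) = H (u j)" if "j \<in> {1..card T}" for j
    using eT[OF that] T(2) by (auto simp: u_def)
  have "v = fst (\<Sum>x\<in>T. w x *\<^sub>R x)" "r = snd (\<Sum>x\<in>T. w x *\<^sub>R x)"
    using w(3) by auto
  then have vr: "v = (\<Sum>j=1..card T. w (e j) *\<^sub>R u j)" "r = (\<Sum>j=1..card T. w (e j) * snd (e j))"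
    by (simp_all add: fst_sum snd_sum u_def sum.reindex_bij_betw[OF e, symmetric])
  have "(\<Sum>j=1..?N. ereal (a j) * h (u j)) = (\<Sum>j=1..card T. ereal (a j) * h (u j))"
    by (rule ext) (auto simp: a_def)
  also have "\<dots> = (\<Sum>j=1..card T. ereal (w (e j) * snd (e j)))"
    by (rule sum.cong) (use eS h in \<open>auto simp: a_def\<close>)
  also have "\<dots> = ereal r"
    by (simp add: vr(2))
  finally have "ereal r = (\<Sum>j=1..?N. ereal (a j) * h (u j))" ..
  moreover have "v = (\<Sum>j=1..?N. a j *\<^sub>R u j)"
    by (subst ext) (auto simp: a_def vr(1) intro: sum.cong)
  moreover have "(\<Sum>j=1..?N. a j) = 1"
  proof -
    have "(\<Sum>j=1..?N. a j) = (\<Sum>j=1..card T. w (e j))"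
      by (subst ext) (auto simp: a_def)
    then show ?thesis
      using w(2) sum.reindex_bij_betw[OF e, of w] by simp
  qed
  moreover have "\<forall>j\<in>{1..?N}. 0 \<le> a j"
    using w(1) eT by (auto simp: a_def)
  ultimately show ?thesis
    unfolding convex_closure_def by (intro Inf_lower) blast
qed

text \<open>Compactness of \<open>S\<close> and continuity of \<open>H\<close> make the hull of the
  graph compact, so it can be strictly separated from the closed ray below (0, \<open>s\<close>),
  which it misses by the previous lemma. The separating hyperplane is the graph of an affine
  minorant, up to a vertical shift.\<close>

lemma affine_minorant_near_convex_closure:
  fixes h :: "'a::euclidean_space \<Rightarrow> ereal"
  assumes h: "\<And>u. h u = (if u \<in> S then ereal (H u) else \<infinity>)"
    and "compact S" "continuous_on S H" "0 \<in> S" and s: "ereal s < convex_closure h 0"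
  shows "\<exists>\<theta>. \<forall>u. ereal (\<theta> \<bullet> u + s) \<le> h u"
proof -
  let ?K = "convex hull ((\<lambda>u. (u, H u)) ` S)"
  let ?R = "{0 :: 'a} \<times> {..s}"
  have "compact ?K"
    using assms by (intro compact_convex_hull compact_continuous_image continuous_intros)
  moreover have "?K \<noteq> {}"
    using \<open>0 \<in> S\<close> by auto
  moreover have "convex ?R" "closed ?R"
    by (auto intro: convex_Times closed_Times)
  moreover have "?R \<inter> ?K = {}"
  proof -
    have "r > s" if "(0, r) \<in> ?K" for r
      using convex_closure_le_if_mem_hull_graph[of S h H, OF _ that] h s
      by (metis ereal_less(2) less_ereal.simps(1) order_less_le_trans)
    then show ?thesis by fastforce
  qed
  ultimately obtain c b where
    "\<forall>x\<in>?R. c \<bullet> x < b" "\<forall>x\<in>?K. c \<bullet> x > b"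
    using separating_hyperplane_closed_compact[of ?R ?K] by auto
  then obtain p \<beta> where R: "\<And>r. r \<le> s \<Longrightarrow> \<beta> * r < b"
    and K: "\<And>u. u \<in> S \<Longrightarrow> b < p \<bullet> u + \<beta> * H u"
    by (cases c) (force dest: bspec[OF _ hull_inc])
  \<comment> \<open>A vertical hyperplane cannot separate two points over 0, and a negative
    \<open>\<beta>\<close> fails because the ray is unbounded below.\<close>
  have "0 < \<beta>"
  proof (rule ccontr)
    assume "\<not> 0 < \<beta>"
    then consider "\<beta> = 0" | "\<beta> < 0" by linarith
    then show False
    proof cases
      case 1
      with R[of s] K[OF \<open>0 \<in> S\<close>] show False by simp
    next
      case 2
      then have "\<beta> * min s (b / \<beta>) \<ge> \<beta> * (b / \<beta>)"
        by (intro mult_left_mono_neg) auto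
      with 2 R[of "min s (b / \<beta>)"] show False by simp
    qed
  qed
  have "ereal ((- p /\<^sub>R \<beta>) \<bullet> u + s) \<le> h u" for u
  proof (cases "u \<in> S")
    case True
    have "\<beta> * s < p \<bullet> u + \<beta> * H u"
      using R[of s] K[OF True] by simp
    with \<open>0 < \<beta>\<close> have "s < (p \<bullet> u) / \<beta> + H u"
      by (simp add: field_simps)
    with True show ?thesis
      by (simp add: h divide_inverse_commute)
  qed (simp add: h)
  then show ?thesis by blast
qed


section \<open>Rounding a convex combination to a list of points\<close>

lemma sum_list_replicate_scaleR:
  fixes c :: "'a::real_vector"
  shows "sum_list (replicate n c) = real n *\<^sub>R c"
  by (induction n) (auto simp: scaleR_add_left)

lemma sum_list_map_concat_replicate:
  fixes g :: "'a \<Rightarrow> 'b::real_vector"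
  shows "sum_list (map g (concat (map (\<lambda>j. replicate (n j) (x j)) js)))
    = (\<Sum>j\<leftarrow>js. real (n j) *\<^sub>R g (x j))"
  by (induction js) (auto simp: sum_list_replicate_scaleR)

text \<open>
  A convex combination that is nearly optimal for the convex closure is turned into a list of
  \<open>I\<close> points by rounding the weights \<open>I * a j\<close> down. The rounding errors sum to an integer below
  \<open>DIM('a) + 2\<close>, so only that many copies of their barycentre pay the nonconvexity gap. For
  identical summands this replaces the Shapley--Folkman lemma.
\<close>
lemma ex_list_near_convex_closure:
  fixes h :: "'a::euclidean_space \<Rightarrow> ereal"
  assumes h: "\<And>u. h u = (if u \<in> S then ereal (H u) else \<infinity>)"
    and "convex S" "0 \<in> S" "0 \<le> d"
    and gap: "\<And>u. u \<in> S \<Longrightarrow> h u \<le> convex_closure h u + ereal d"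
    and s: "convex_closure h 0 < ereal s"
  shows "\<exists>xs. length xs = I \<and> set xs \<subseteq> S \<and> sum_list xs = 0
    \<and> sum_list (map H xs) \<le> real I * s + real (DIM('a) + 1) * d"
proof -
  let ?J = "{1..DIM('a) + 2}"
  obtain a :: "nat \<Rightarrow> real" and u0 :: "nat \<Rightarrow> 'a"
    where lt: "(\<Sum>j\<in>?J. ereal (a j) * h (u0 j)) < ereal s"
      and zero0: "0 = (\<Sum>j\<in>?J. a j *\<^sub>R u0 j)"
      and sum_a: "(\<Sum>j\<in>?J. a j) = 1" and a_nonneg: "\<And>j. j \<in> ?J \<Longrightarrow> 0 \<le> a j"
    using s unfolding convex_closure_def Inf_less_iff by blast
  \<comment> \<open>A point of weight 0 may lie outside \<open>S\<close> and is replaced by 0; a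
    point of positive weight lies in \<open>S\<close>, since otherwise the sum would be
    infinite.\<close>
  define u where "u j = (if a j = 0 then 0 else u0 j)" for j
  have uS: "u j \<in> S" if j: "j \<in> ?J" for j
  proof (rule ccontr)
    assume "u j \<notin> S"
    with \<open>0 \<in> S\<close> have "a j \<noteq> 0" "u0 j \<notin> S" by (auto simp: u_def split: if_splits)
    then have "ereal (a j) * h (u0 j) = \<infinity>"
      using a_nonneg[OF j] by (simp add: h)
    with j have "(\<Sum>j\<in>?J. ereal (a j) * h (u0 j)) = \<infinity>"
      by (subst sum_Pinfty) blast
    with lt have "\<infinity> < ereal s" by (simp only:)
    then show False by simp
  qed
  have zero: "(\<Sum>j\<in>?J. a j *\<^sub>R u j) = 0"
    unfolding zero0 by (rule sum.cong) (auto simp: u_def)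
  have "(\<Sum>j\<in>?J. ereal (a j) * h (u0 j)) = (\<Sum>j\<in>?J. ereal (a j * H (u j)))"
  proof (rule sum.cong)
    fix j assume "j \<in> ?J"
    from uS[OF this] show "ereal (a j) * h (u0 j) = ereal (a j * H (u j))"
      by (cases "a j = 0") (auto simp: u_def h zero_ereal_def[symmetric])
  qed simp
  with lt have aH: "(\<Sum>j\<in>?J. a j * H (u j)) < s" by simp

  define n where "n j = nat \<lfloor>real I * a j\<rfloor>" for j
  define c where "c j = real I * a j - real (n j)" for j
  have c: "0 \<le> c j" "c j < 1" if "j \<in> ?J" for j
  proof -
    have "0 \<le> real I * a j" using a_nonneg[OF that] by simp
    then show "0 \<le> c j" "c j < 1" unfolding c_def n_def by linarith+
  qed
  have sum_c: "(\<Sum>j\<in>?J. c j) = real I - real (\<Sum>j\<in>?J. n j)"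
    using sum_a by (simp only: c_def sum_subtractf sum_distrib_left[symmetric] of_nat_sum mult_1_right)
  have "0 \<le> (\<Sum>j\<in>?J. c j)"
    using c by (intro sum_nonneg) auto
  then have n_le: "(\<Sum>j\<in>?J. n j) \<le> I"
    unfolding sum_c by linarith
  define m where "m = I - (\<Sum>j\<in>?J. n j)"
  have m: "real m = (\<Sum>j\<in>?J. c j)"
    unfolding sum_c m_def using n_le by linarith
  \<comment> \<open>The strict inequality makes the integer \<open>m\<close> less than
    \<open>DIM('a) + 2\<close>; this is the source of the factor \<open>t + 1\<close>.\<close>
  have "(\<Sum>j\<in>?J. c j) < (\<Sum>j\<in>?J. 1)"
    using c by (intro sum_strict_mono) auto
  then have m_le: "m \<le> DIM('a) + 1"
    unfolding m[symmetric] by simp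
  \<comment> \<open>For \<open>m = 0\<close> all \<open>c j\<close> vanish and no copy of
    \<open>v\<close> enters the list, so the division by zero is harmless.\<close>
  define v where "v = (\<Sum>j\<in>?J. (c j / real m) *\<^sub>R u j)"
  have c0: "c j = 0" if "m = 0" "j \<in> ?J" for j
    using that m c sum_nonneg_eq_0_iff[of ?J c] by (metis finite_atLeastAtMost of_nat_0)
  have weights: "(\<Sum>j\<in>?J. c j / real m) = 1" if "m > 0"
    using that m by (simp add: sum_divide_distrib[symmetric])
  have mv: "real m *\<^sub>R v = (\<Sum>j\<in>?J. c j *\<^sub>R u j)"
  proof (cases "m = 0")
    case True
    have "(\<Sum>j\<in>?J. c j *\<^sub>R u j) = 0"
      by (rule sum.neutral) (use c0[OF True] in simp)
    with True show ?thesis by simp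
  qed (simp add: v_def scaleR_sum_right del: sum.cl_ivl_Suc)
  have vS: "v \<in> S" if "m > 0"
    unfolding v_def using \<open>convex S\<close> uS c weights[OF that]
    by (intro convex_sum) auto
  \<comment> \<open>The weights \<open>c j / m\<close> bound the convex closure at \<open>v\<close>,
    and \<open>gap\<close> turns this into a bound on \<open>H v\<close> at the cost of
    \<open>d\<close>.\<close>
  have Hv: "real m * H v \<le> (\<Sum>j\<in>?J. c j * H (u j)) + real m * d"
  proof (cases "m = 0")
    case True
    have "(\<Sum>j\<in>?J. c j * H (u j)) = 0"
      by (rule sum.neutral) (use c0[OF True] in simp)
    with True show ?thesis by simp
  next
    case False
    then have "m > 0" by simp
    have "convex_closure h v \<le> (\<Sum>j\<in>?J. ereal (c j / real m) * h (u j))"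
      unfolding convex_closure_def
      using c weights[OF \<open>m > 0\<close>] v_def by (intro Inf_lower CollectI exI conjI) auto
    also have "\<dots> = (\<Sum>j\<in>?J. ereal (c j / real m * H (u j)))"
      using uS by (intro sum.cong) (auto simp: h)
    also have "\<dots> = ereal ((\<Sum>j\<in>?J. c j * H (u j)) / real m)"
      by (simp add: sum_divide_distrib del: sum.cl_ivl_Suc)
    finally have "h v \<le> ereal ((\<Sum>j\<in>?J. c j * H (u j)) / real m) + ereal d"
      using gap[OF vS[OF \<open>m > 0\<close>]] by (meson add_right_mono order_trans)
    then have "H v \<le> (\<Sum>j\<in>?J. c j * H (u j)) / real m + d"
      using vS[OF \<open>m > 0\<close>] by (simp add: h)
    with \<open>m > 0\<close> show ?thesis
      by (simp add: field_simps)
  qed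

  define xs where
    "xs = concat (map (\<lambda>j. replicate (n j) (u j)) [1..<DIM('a) + 3]) @ replicate m v"
  \<comment> \<open>Used with \<open>g\<close> constantly 1 for the length, the identity for the
    vector sum, and \<open>H\<close> for the cost.\<close>
  have sum_xs: "sum_list (map g xs) = (\<Sum>j\<in>?J. real (n j) *\<^sub>R g (u j)) + real m *\<^sub>R g v"
    for g :: "'a \<Rightarrow> 'c::real_vector"
  proof -
    have "set [1..<DIM('a) + 3] = ?J" by auto
    then show ?thesis
      unfolding xs_def map_append sum_list_append sum_list_map_concat_replicate map_replicate
        sum_list_replicate_scaleR
      by (simp only: sum_list_distinct_conv_sum_set distinct_upt)
  qed
  have "real (length xs) = sum_list (map (\<lambda>_. 1) xs)"
    by (induction xs) auto
  also have "\<dots> = real (\<Sum>j\<in>?J. n j) + real m"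
    by (subst sum_xs) (simp del: sum.cl_ivl_Suc)
  finally have "length xs = I"
    using n_le unfolding m_def by linarith
  moreover have "set xs \<subseteq> S"
    using uS vS by (auto simp: xs_def)
  moreover have "sum_list xs = 0"
  proof -
    \<comment> \<open>Since \<open>n j + c j = I * a j\<close>, the fractional parts carried by
      \<open>v\<close> undo the rounding.\<close>
    have "sum_list xs = (\<Sum>j\<in>?J. real (n j) *\<^sub>R u j) + (\<Sum>j\<in>?J. c j *\<^sub>R u j)"
      using sum_xs[of "\<lambda>x. x"] mv by simp
    also have "\<dots> = (\<Sum>j\<in>?J. real I *\<^sub>R (a j *\<^sub>R u j))"
      unfolding sum.distrib[symmetric]
      by (rule sum.cong) (auto simp: c_def scaleR_add_left[symmetric])
    also have "\<dots> = 0"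
      by (simp only: scaleR_sum_right[symmetric] zero scaleR_zero_right)
    finally show ?thesis .
  qed
  moreover have "sum_list (map H xs) \<le> real I * s + real (DIM('a) + 1) * d"
  proof -
    have "sum_list (map H xs) = (\<Sum>j\<in>?J. real (n j) * H (u j)) + real m * H v"
      using sum_xs[of H] by simp
    also have "\<dots> \<le> (\<Sum>j\<in>?J. real (n j) * H (u j)) + ((\<Sum>j\<in>?J. c j * H (u j)) + real m * d)"
      using Hv by (rule add_left_mono)
    also have "\<dots> = (\<Sum>j\<in>?J. real I * (a j * H (u j))) + real m * d"
      unfolding add.assoc[symmetric] sum.distrib[symmetric]
      by (simp add: c_def algebra_simps del: sum.cl_ivl_Suc)
    also have "\<dots> = real I * (\<Sum>j\<in>?J. a j * H (u j)) + real m * d"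
      by (simp only: sum_distrib_left)
    also have "\<dots> \<le> real I * s + real (DIM('a) + 1) * d"
      using aH m_le \<open>0 \<le> d\<close> by (intro add_mono mult_left_mono mult_right_mono) auto
    finally show ?thesis .
  qed
  ultimately show ?thesis by blast
qed

section \<open>Bounds on the minimax and maximin values\<close>

text \<open>A generator nearly attaining the infimum in \<open>gen_h\<close> at \<open>u\<close> has
  payoff at most \<open>H u + e - \<theta> \<bullet> u\<close> for every \<open>\<theta>\<close>.
  Over points with sum 0 the linear terms cancel, which leaves a bound independent of
  \<open>\<theta>\<close>.\<close>

lemma minimax_value_le_average:
  fixes \<phi> :: "'ga \<Rightarrow> 'th::real_inner \<Rightarrow> ereal"
  assumes h: "\<And>u. u \<in> set xs \<Longrightarrow> gen_h \<phi> i u = ereal (H u)"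
    and "sum_list xs = 0" "length xs = I" "I > 0"
  shows "minimax_value \<phi> I \<le> ereal (sum_list (map H xs) / real I)"
proof (rule ereal_le_epsilon2)
  fix e :: real assume "0 < e"
  have "\<exists>\<gamma>. conjugate (\<lambda>\<theta>. - \<phi> \<gamma> \<theta>) u < ereal (H u + e)" if "u \<in> set xs" for u
  proof -
    have "gen_h \<phi> i u < ereal (H u + e)"
      using h[OF that] \<open>0 < e\<close> by simp
    then show ?thesis
      unfolding gen_h_def INF_less_iff by blast
  qed
  then obtain \<Gamma> where \<Gamma>: "\<And>u. u \<in> set xs \<Longrightarrow> conjugate (\<lambda>\<theta>. - \<phi> (\<Gamma> u) \<theta>) u < ereal (H u + e)"
    by metis
  have le: "\<phi> (\<Gamma> u) \<theta> \<le> ereal (H u + e - \<theta> \<bullet> u)" if "u \<in> set xs" for u \<theta>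
  proof -
    have "ereal (\<theta> \<bullet> u) - - \<phi> (\<Gamma> u) \<theta> \<le> conjugate (\<lambda>\<theta>. - \<phi> (\<Gamma> u) \<theta>) u"
      unfolding conjugate_def by (rule SUP_upper) simp
    also have "\<dots> \<le> ereal (H u + e)"
      using \<Gamma>[OF that] by simp
    finally show ?thesis
      by (cases "\<phi> (\<Gamma> u) \<theta>") auto
  qed
  \<comment> \<open>Generators are numbered from 1, list positions from 0.\<close>
  let ?\<gamma> = "\<lambda>i\<in>{1..I}. \<Gamma> (xs ! (i - 1))"
  have "minimax_value \<phi> I \<le> (SUP \<theta>. ereal (1 / real I) * total_payoff \<phi> I ?\<gamma> \<theta>)"
    unfolding minimax_value_def by (rule INF_lower) auto
  also have "\<dots> \<le> ereal (sum_list (map H xs) / real I + e)"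
  proof (rule SUP_least)
    fix \<theta>
    have "total_payoff \<phi> I ?\<gamma> \<theta> \<le> (\<Sum>i=1..I. ereal (H (xs ! (i - 1)) + e - \<theta> \<bullet> xs ! (i - 1)))"
      unfolding total_payoff_def
    proof (rule sum_mono)
      fix i assume "i \<in> {1..I}"
      then have "xs ! (i - 1) \<in> set xs"
        using \<open>length xs = I\<close> by (intro nth_mem) auto
      from le[OF this] \<open>i \<in> {1..I}\<close> show "\<phi> (?\<gamma> i) \<theta> \<le> ereal (H (xs ! (i - 1)) + e - \<theta> \<bullet> xs ! (i - 1))"
        by simp
    qed
    also have "\<dots> = ereal (sum_list (map (\<lambda>u. H u + e - \<theta> \<bullet> u) xs))"
      using \<open>length xs = I\<close>
      by (simp add: sum_list_sum_nth atLeast0LessThan sum.atLeast1_atMost_eq)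
    also have "sum_list (map (\<lambda>u. H u + e - \<theta> \<bullet> u) xs)
        = sum_list (map H xs) + real (length xs) * e - \<theta> \<bullet> sum_list xs"
      by (induction xs) (auto simp: inner_add_right algebra_simps)
    also have "\<dots> = real I * (sum_list (map H xs) / real I + e)"
      using assms(2-4) by (simp add: field_simps)
    finally have "ereal (1 / real I) * total_payoff \<phi> I ?\<gamma> \<theta>
        \<le> ereal (1 / real I) * ereal (real I * (sum_list (map H xs) / real I + e))"
      by (rule ereal_mult_left_mono) simp
    also have "\<dots> = ereal (sum_list (map H xs) / real I + e)"
      using \<open>I > 0\<close> by simp
    finally show "ereal (1 / real I) * total_payoff \<phi> I ?\<gamma> \<theta>
        \<le> ereal (sum_list (map H xs) / real I + e)" .
  qed
  finally show "minimax_value \<phi> I \<le> ereal (sum_list (map H xs) / real I) + ereal e"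
    by simp
qed

lemma maximin_value_le_minimax_value: "maximin_value \<phi> I \<le> minimax_value \<phi> I"
  unfolding maximin_value_def minimax_value_def
  by (intro SUP_least INF_greatest) (rule order_trans[OF INF_lower SUP_upper]; simp)

lemma maximin_value_ge:
  assumes "\<And>\<gamma>. ereal s \<le> \<phi> \<gamma> \<theta>" "I > 0"
  shows "ereal s \<le> maximin_value \<phi> I"
proof -
  have "ereal s \<le> ereal (1 / real I) * total_payoff \<phi> I \<gamma> \<theta>" for \<gamma>
  proof -
    have "(\<Sum>i=1..I. ereal s) \<le> total_payoff \<phi> I \<gamma> \<theta>"
      unfolding total_payoff_def by (intro sum_mono assms)
    then have "ereal (1 / real I) * (\<Sum>i=1..I. ereal s) \<le> ereal (1 / real I) * total_payoff \<phi> I \<gamma> \<theta>"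
      by (rule ereal_mult_left_mono) simp
    moreover have "ereal (1 / real I) * (\<Sum>i=1..I. ereal s) = ereal s"
      using \<open>I > 0\<close> by simp
    ultimately show ?thesis by simp
  qed
  then show ?thesis
    unfolding maximin_value_def by (intro SUP_upper2[of \<theta>] INF_greatest) auto
qed

section \<open>Upper bound on the payoff\<close>

text \<open>The integral of the positive part is already at most \<open>c\<close>, as
  \<open>c\<close> is nonnegative; subtracting the other integral only lowers the value.\<close>

lemma ereal_expectation_le:
  assumes "prob_space M" and "\<And>x. x \<in> space M \<Longrightarrow> X x \<le> ereal c" and "0 \<le> c"
  shows "ereal_expectation M X \<le> ereal c"
proof -
  interpret prob_space M by fact
  have "(\<integral>\<^sup>+ x. e2ennreal (X x) \<partial>M) \<le> (\<integral>\<^sup>+ x. ennreal c \<partial>M)"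
    using assms(2) by (intro nn_integral_mono) (metis e2ennreal_ereal e2ennreal_mono)
  also have "\<dots> = ennreal c"
    by (simp add: emeasure_space_1)
  finally have "enn2ereal (\<integral>\<^sup>+ x. e2ennreal (X x) \<partial>M) \<le> ereal c"
    using \<open>0 \<le> c\<close> by (metis enn2ereal_ennreal less_eq_ennreal.rep_eq)
  then have "enn2ereal (\<integral>\<^sup>+ x. e2ennreal (X x) \<partial>M) - enn2ereal (\<integral>\<^sup>+ x. e2ennreal (- X x) \<partial>M)
      \<le> ereal c - 0"
    by (intro ereal_minus_mono) auto
  then show ?thesis
    unfolding ereal_expectation_def by simp
qed

text \<open>Monotonicity bounds \<open>f\<close> on the unit interval by \<open>f 1\<close>. The
  resulting constant is uniform in both parameters, as biconjugation and the finiteness of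
  \<open>gen_h\<close> at 0 from above require.\<close>

lemma payoff_bounded_above:
  assumes "prob_space Pd" "prob_space Pz"
    and G: "\<And>\<gamma>. G \<gamma> \<in> measurable Pz Pd"
    and D: "\<And>\<theta> x. x \<in> space Pd \<Longrightarrow> D \<theta> x \<in> {0..1}"
    and f: "mono_on {0..1} f" "f 1 < \<infinity>"
  obtains C where "\<And>\<gamma> \<theta>. payoff Pd Pz f D G \<gamma> \<theta> \<le> ereal C"
proof -
  define c where "c = max 0 (real_of_ereal (f 1))"
  have "f p \<le> ereal c" if "p \<in> {0..1}" for p
  proof -
    have "f p \<le> f 1" using that by (intro mono_onD[OF f(1)]) auto
    also have "\<dots> \<le> ereal c" using f(2) by (cases "f 1") (auto simp: c_def)
    finally show ?thesis .
  qed
  moreover have "1 - D \<theta> x \<in> {0..1}" if "x \<in> space Pd" for \<theta> x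
    using D[OF that] by auto
  moreover have "G \<gamma> z \<in> space Pd" if "z \<in> space Pz" for \<gamma> z
    using G that by (rule measurable_space)
  ultimately have "payoff Pd Pz f D G \<gamma> \<theta> \<le> ereal c + ereal c" for \<gamma> \<theta>
    unfolding payoff_def using D
    by (intro add_mono ereal_expectation_le assms(1,2)) (simp_all add: c_def)
  then show ?thesis
    using that[of "c + c"] by simp
qed

section \<open>The duality gap\<close>

text \<open>The constant \<open>c\<close> is the convex closure of \<open>gen_h \<phi> i\<close> at
  0. It is real: \<open>h 0\<close> bounds it above, and \<open>gap\<close> at 0 bounds it
  below.\<close>

lemma duality_gap_bounds:
  fixes \<phi> :: "'ga \<Rightarrow> 'th::euclidean_space \<Rightarrow> ereal"
  assumes bound: "\<And>\<gamma> \<theta>. \<phi> \<gamma> \<theta> \<le> ereal C" and closed: "\<And>\<gamma>. closed_concave (\<phi> \<gamma>)" and "I > 0"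
    and h: "\<And>u. gen_h \<phi> i u = (if u \<in> S then ereal (H u) else \<infinity>)"
    and S: "compact S" "convex S" "continuous_on S H"
    and gap: "\<And>u. u \<in> S \<Longrightarrow> gen_h \<phi> i u \<le> convex_closure (gen_h \<phi> i) u + ereal d" and "0 \<le> d"
  obtains c where "ereal c \<le> maximin_value \<phi> I"
    and "minimax_value \<phi> I \<le> ereal (c + real (DIM('th) + 1) * d / real I)"
proof -
  let ?h = "gen_h \<phi> i"
  have h_le: "?h u \<le> conjugate (\<lambda>\<theta>. - \<phi> \<gamma> \<theta>) u" for u \<gamma>
    unfolding gen_h_def by (rule INF_lower) simp
  have "conjugate (\<lambda>\<theta>. - \<phi> \<gamma> \<theta>) 0 \<le> ereal C" for \<gamma>
    unfolding conjugate_def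
  proof (rule SUP_least)
    fix \<theta> show "ereal (\<theta> \<bullet> 0) - - \<phi> \<gamma> \<theta> \<le> ereal C"
      using bound[of \<gamma> \<theta>] by (cases "\<phi> \<gamma> \<theta>") auto
  qed
  then have "?h 0 \<le> ereal C"
    using h_le order_trans by blast
  then have "0 \<in> S"
    using h[of 0] by (auto split: if_splits)
  have "convex_closure ?h 0 \<le> ?h 0"
    by (rule convex_closure_le)
  with gap[OF \<open>0 \<in> S\<close>] \<open>0 \<in> S\<close> obtain c where c: "convex_closure ?h 0 = ereal c"
    by (cases "convex_closure ?h 0") (auto simp: h)
  show ?thesis
  proof (rule that[of c])
    show "ereal c \<le> maximin_value \<phi> I"
    proof (rule ccontr)
      assume "\<not> ereal c \<le> maximin_value \<phi> I"
      then obtain s where s: "maximin_value \<phi> I < ereal s" "ereal s < convex_closure ?h 0"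
        unfolding c by (meson ereal_dense2 not_le)
      obtain \<theta> where \<theta>: "\<And>u. ereal (\<theta> \<bullet> u + s) \<le> ?h u"
        using affine_minorant_near_convex_closure[OF h S(1,3) \<open>0 \<in> S\<close> s(2)] by blast
      \<comment> \<open>The affine minorant of \<open>h\<close> lies below the conjugate for each
        \<open>\<gamma>\<close>, so one \<open>\<theta>\<close> serves all generators.\<close>
      have "ereal s \<le> \<phi> \<gamma> \<theta>" for \<gamma>
        using closed bound order_trans[OF \<theta> h_le]
        by (rule closed_concave_ge_if_conjugate_ge)
      then have "ereal s \<le> maximin_value \<phi> I"
        using \<open>I > 0\<close> by (rule maximin_value_ge)
      with s(1) show False by simp
    qed
    show "minimax_value \<phi> I \<le> ereal (c + real (DIM('th) + 1) * d / real I)"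
    proof (rule ereal_le_epsilon2)
      fix e :: real assume "0 < e"
      then have "convex_closure ?h 0 < ereal (c + e)"
        by (simp add: c)
      from ex_list_near_convex_closure[OF h S(2) \<open>0 \<in> S\<close> \<open>0 \<le> d\<close> gap this, of I]
      obtain xs where xs: "length xs = I" "set xs \<subseteq> S" "sum_list xs = 0"
        "sum_list (map H xs) \<le> real I * (c + e) + real (DIM('th) + 1) * d"
        by blast
      have "minimax_value \<phi> I \<le> ereal (sum_list (map H xs) / real I)"
        using xs(2) by (intro minimax_value_le_average[OF _ xs(3,1) \<open>I > 0\<close>, of _ i]) (auto simp: h)
      also have "sum_list (map H xs) / real I
          \<le> (real I * (c + e) + real (DIM('th) + 1) * d) / real I"
        using xs(4) by (rule divide_right_mono) simp
      also have "\<dots> = c + real (DIM('th) + 1) * d / real I + e"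
        using \<open>I > 0\<close> by (simp add: add_divide_distrib)
      finally show "minimax_value \<phi> I \<le> ereal (c + real (DIM('th) + 1) * d / real I) + ereal e"
        by simp
    qed
  qed
qed

text \<open>If \<open>h u\<close> or its convex closure were \<open>-\<infinity>\<close>, the
  difference would be \<open>\<infinity>\<close>, also in the case
  \<open>-\<infinity> - (-\<infinity>)\<close>, contradicting the finite supremum.\<close>

lemma nonconvexity_finite_imp_real:
  assumes "nonconvexity h = ereal d" "u \<in> eff_dom h"
  shows "\<bar>h u\<bar> \<noteq> \<infinity>" and "h u \<le> convex_closure h u + ereal d"
proof -
  have "h u - convex_closure h u \<le> ereal d"
    using assms unfolding nonconvexity_def
    by (metis (mono_tags, lifting) SUP_upper UNIV_I)
  then show "\<bar>h u\<bar> \<noteq> \<infinity>" "h u \<le> convex_closure h u + ereal d"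
    using assms(2) convex_closure_le[of h u]
    by (cases "h u"; cases "convex_closure h u"; simp add: eff_dom_def)+
qed

theorem corollary2:
  fixes Pd :: "'x measure" and Pz :: "'z measure"
    and f :: "real \<Rightarrow> ereal"
    and D :: "real ^ 't \<Rightarrow> 'x \<Rightarrow> real"
    and G :: "real ^ 'g \<Rightarrow> 'z \<Rightarrow> 'x"
    and \<phi> :: "real ^ 'g \<Rightarrow> real ^ 't \<Rightarrow> ereal"
    and \<epsilon> :: real and I :: nat
  assumes "prob_space Pd" and "prob_space Pz"
    and "\<And>\<theta>. D \<theta> \<in> borel_measurable Pd"
    and "\<And>\<gamma>. G \<gamma> \<in> measurable Pz Pd"
    and "\<And>\<theta> x. x \<in> space Pd \<Longrightarrow> D \<theta> x \<in> {0..1}"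
    and "mono_on {0..1} f" and "ereal_concave_on {0..1} f"
    and "\<And>p. p \<in> {0..1} \<Longrightarrow> f p < \<infinity>"
    and "\<phi> = payoff Pd Pz f D G"
    and "\<epsilon> > 0" and "I > 0"
    and "\<And>i. i \<in> {1..I} \<Longrightarrow> continuous_on (eff_dom (gen_h \<phi> i)) (gen_h \<phi> i)"
    and "\<And>i. i \<in> {1..I} \<Longrightarrow> compact (eff_dom (gen_h \<phi> i))"
    and "\<And>i. i \<in> {1..I} \<Longrightarrow> convex (eff_dom (gen_h \<phi> i))"
    and "\<And>\<gamma>. closed_concave (\<phi> \<gamma>)"
    and "ereal (real I) > ereal ((real CARD('t) + 1) / \<epsilon>) * worst_nonconvexity \<phi> I"
  shows "0 \<le> minimax_value \<phi> I - maximin_value \<phi> I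
       \<and> minimax_value \<phi> I - maximin_value \<phi> I \<le> ereal \<epsilon>"
proof -
  let ?h = "gen_h \<phi> 1"
  let ?S = "eff_dom ?h"
  let ?H = "real_of_ereal \<circ> ?h"
  have I1: "1 \<in> {1..I}"
    using \<open>I > 0\<close> by simp
  have "(\<lambda>i. nonconvexity (gen_h \<phi> i)) = (\<lambda>_. nonconvexity ?h)"
    by (simp add: gen_h_def[abs_def])
  then have worst: "worst_nonconvexity \<phi> I = nonconvexity ?h"
    using image_constant[OF I1, of "nonconvexity ?h"] by (simp only: worst_nonconvexity_def Max_singleton)
  \<comment> \<open>An infinite value times the positive factor \<open>(t + 1) / \<epsilon>\<close>
    would exceed \<open>I\<close>.\<close>
  have "nonconvexity ?h \<noteq> \<infinity>"
    using assms(16) \<open>\<epsilon> > 0\<close> unfolding worst by auto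
  with nonconvexity_nonneg[of ?h] obtain d where d: "nonconvexity ?h = ereal d" "0 \<le> d"
    by (cases "nonconvexity ?h") auto
  note real = nonconvexity_finite_imp_real[OF d(1)]
  have f1: "f 1 < \<infinity>"
    using assms(8) by simp
  obtain C where "\<And>\<gamma> \<theta>. payoff Pd Pz f D G \<gamma> \<theta> \<le> ereal C"
    using payoff_bounded_above[where G = G and D = D, OF assms(1,2,4,5,6) f1] by blast
  then have bound: "\<phi> \<gamma> \<theta> \<le> ereal C" for \<gamma> \<theta>
    using assms(9) by simp
  have h: "?h u = (if u \<in> ?S then ereal (?H u) else \<infinity>)" for u
    using real(1)[of u] by (auto simp: ereal_real eff_dom_def)
  \<comment> \<open>Finiteness on the domain lets continuity pass from \<open>ereal\<close> to
    \<open>real\<close>.\<close>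
  have "continuous_on ?S ?H"
    using assms(12)[OF I1] continuous_on_iff_real[of ?S ?h] real(1) by simp
  with duality_gap_bounds[OF bound assms(15) \<open>I > 0\<close> h assms(13)[OF I1] assms(14)[OF I1] _ real(2) d(2)]
  obtain c where q: "ereal c \<le> maximin_value \<phi> I"
    and w: "minimax_value \<phi> I \<le> ereal (c + real (DIM(real ^ 't) + 1) * d / real I)"
    by blast
  have "(real CARD('t) + 1) / \<epsilon> * d < real I"
    using assms(16) unfolding worst d(1) by simp
  then have "real (DIM(real ^ 't) + 1) * d / real I \<le> \<epsilon>"
    using \<open>\<epsilon> > 0\<close> \<open>I > 0\<close> by (simp add: field_simps)
  \<comment> \<open>By weak duality both values lie between two real numbers, so their
    \<open>ereal\<close> difference is an ordinary one.\<close>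
  with q w maximin_value_le_minimax_value[of \<phi> I] show ?thesis
    by (cases "minimax_value \<phi> I"; cases "maximin_value \<phi> I") auto
qed

end
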